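(* Let $f:\mathbb{R}^k\to\mathbb{R}$ be twice differentiable, $L$-smooth and $\mu$-strongly convex with $L,\mu>0$, and let $x^*$ be its minimizer. Let $0<\alpha<1$, $\beta\in\mathbb{R}$, $\gamma=\frac{1-\alpha}{2-\alpha}$, and set $$K_1=\tfrac{L+\mu}{2}(\beta-\gamma),\qquad K_2=\begin{cases}\tfrac{L-\mu}{2}(\beta+\gamma)&\text{if }\beta\ge0,\\ \tfrac{\mu-L}{2}(\beta-\gamma)&\text{if }\beta\le0.\end{cases}$$ Let $0<\phi<2$, $\epsilon>0$, and let $(\lambda_t)_{t\ge0}$ be real numbers with $\frac{\phi(1-K_1\lambda_t)}{L}-\frac{2K_2|\lambda_t|}{\mu}>\epsilon$ for all $t$. Let $x_0\in\mathbb{R}^k$ and define, for $t\ge0$, $$x_{t+1}=x_t-\eta_t\,{}^{C}\delta^{\alpha,\beta}_{c_t}f(x_t),\qquad \eta_t=\frac{\frac{\phi}{L}(1-K_1\lambda_t)-\frac{2K_2|\lambda_t|}{\mu}}{(1-K_1\lambda_t+K_2|\lambda_t|)^2},\qquad x_t-c_t=-\lambda_t\nabla f(x_t).$$ Then for all $t\ge0$, $$\|x_{t+1}-x^*\|_2^2\le\left[1-\frac{(2-\phi)\mu(1-K_1\lambda_t)\left[\frac{\phi}{L}(1-K_1\lambda_t)-\frac{2K_2|\lambda_t|}{\mu}\right]}{(1-K_1\lambda_t+K_2|\lambda_t|)^2}\right]\|x_t-x^*\|_2^2 .$$ In particular, this rate is at best the same as that of gradient descent: the outer bracketed factor is at least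 $1-\frac{\mu}{L}$.
   Context: $x^{(i)}$ denotes the $i$th coordinate of $x\in\mathbb{R}^k$. $f:\mathbb{R}^k\to\mathbb{R}$ is $L$-smooth if $|f(y)-f(x)-\langle\nabla f(x),y-x\rangle|\le\frac L2\|y-x\|_2^2$ for all $x,y$, and $\mu$-strongly convex if $f(y)-f(x)-\langle\nabla f(x),y-x\rangle\ge\frac\mu2\|y-x\|_2^2$ for all $x,y$. For $g:\mathbb{R}\to\mathbb{R}$, non-integer $\nu>0$, $n=\lceil\nu\rceil$ and real $x\ne c$, the Caputo derivative is $${}^{C}D^{\nu}_{c}g(x)=\frac{(\operatorname{sgn}(x-c))^{n-1}}{\Gamma(n-\nu)}\int_c^x\frac{g^{(n)}(t)}{|x-t|^{\nu-n+1}}\,dt ,$$ with $\operatorname{sgn}$ the sign function, $\Gamma$ the gamma function, and $\int_c^x$ the oriented integral. For $\alpha\in(0,1)$, $\beta\in\mathbb{R}$, real $x\neq c$, $${}^{C}\delta^{\alpha,\beta}_{c}g(x)=\frac{\Gamma(2-\alpha)|x-c|^{\alpha}}{x-c}\Big({}^{C}D^{\alpha}_{c}g(x)+\beta|x-c|\,{}^{C}D^{1+\alpha}_{c}g(x)\Big),$$ and for $c=x$ it is read as its limiting value $g'(x)$. For $f:\mathbb{R}^k\to\mathbb{R}$ and $x,c\in\mathbb{R}^k$, $${}^{C}\delta^{\alpha,\beta}_{c}f(x)=\big[{}^{C}\delta^{\alpha,\beta}_{c^{(1)}}f_{1,x}(x^{(1)}),\dots,{}^{C}\delta^{\alpha,\beta}_{c^{(k)}}f_{k,x}(x^{(k)})\big],\qquad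 f_{j,x}(y)=f\big(x+(y-x^{(j)})e^{(j)}\big),$$ where $e^{(j)}$ is the $j$th standard unit vector. *)

theory Defs
  imports "HOL-Analysis.Analysis"
begin

definition gradient :: "('a::real_inner \<Rightarrow> real) \<Rightarrow> 'a \<Rightarrow> 'a" where
  "gradient f x = (THE D. GDERIV f x :> D)"

lemma gradient_eqI: "GDERIV f x :> D \<Longrightarrow> gradient f x = D"
  unfolding gradient_def gderiv_def
  by (rule the_equality) (auto dest: has_derivative_unique simp: fun_eq_iff vector_eq_ldot)

definition twice_differentiable :: "('a::real_inner \<Rightarrow> real) \<Rightarrow> bool" where
  "twice_differentiable f \<longleftrightarrow>
     (\<forall>x. f differentiable (at x)) \<and> (\<forall>x. gradient f differentiable (at x))"

definition L_smooth :: "real \<Rightarrow> ('a::real_inner \<Rightarrow> real) \<Rightarrow> bool" where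
  "L_smooth L f \<longleftrightarrow>
     (\<forall>x y. \<bar>f y - f x - gradient f x \<bullet> (y - x)\<bar> \<le> L / 2 * (norm (y - x))\<^sup>2)"

definition strongly_convex :: "real \<Rightarrow> ('a::real_inner \<Rightarrow> real) \<Rightarrow> bool" where
  "strongly_convex \<mu> f \<longleftrightarrow>
     (\<forall>x y. f y - f x - gradient f x \<bullet> (y - x) \<ge> \<mu> / 2 * (norm (y - x))\<^sup>2)"

(* Meant for non-integer \<nu> > 0 and x \<noteq> c. The integral is oriented (it changes sign when
   c > x) and runs over the open interval, so the singularity at t = x is not evaluated. *)
definition caputo_deriv :: "real \<Rightarrow> real \<Rightarrow> (real \<Rightarrow> real) \<Rightarrow> real \<Rightarrow> real" where
  "caputo_deriv \<nu> c g x =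
     (let n = nat \<lceil>\<nu>\<rceil> in
        sgn (x - c) ^ (n - 1) / Gamma (real n - \<nu>)
        * (LBINT t=c..x. (deriv ^^ n) g t / \<bar>x - t\<bar> powr (\<nu> - real n + 1)))"

definition caputo_delta :: "real \<Rightarrow> real \<Rightarrow> real \<Rightarrow> (real \<Rightarrow> real) \<Rightarrow> real \<Rightarrow> real" where
  "caputo_delta \<alpha> \<beta> c g x =
     (if c = x then deriv g x
      else Gamma (2 - \<alpha>) * \<bar>x - c\<bar> powr \<alpha> / (x - c)
           * (caputo_deriv \<alpha> c g x + \<beta> * \<bar>x - c\<bar> * caputo_deriv (1 + \<alpha>) c g x))"

definition coord_slice :: "(real ^ 'n \<Rightarrow> real) \<Rightarrow> 'n::finite \<Rightarrow> real ^ 'n \<Rightarrow> real \<Rightarrow> real" where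
  "coord_slice f j x y = f (x + (y - x $ j) *\<^sub>R axis j 1)"

definition caputo_gradient ::
    "real \<Rightarrow> real \<Rightarrow> real ^ 'n \<Rightarrow> (real ^ 'n \<Rightarrow> real) \<Rightarrow> real ^ 'n::finite \<Rightarrow> real ^ 'n" where
  "caputo_gradient \<alpha> \<beta> c f x =
     (\<chi> j. caputo_delta \<alpha> \<beta> (c $ j) (coord_slice f j x) (x $ j))"

end

theory Submission
  imports Defs
begin

text \<open>
  The fractional gradient is an ordinary gradient with a controlled relative error, and the rate
  is that of gradient descent with such an error.

  Substituting \<open>t = x - (x - c) u\<close> in both Caputo integrals writes the scalar operator as the average
  of \<open>g'(x - h u) + \<beta> h g''(x - h u)\<close>, with \<open>h = x - c\<close>, against the probability density
  \<open>(1 - \<alpha>) u\<^sup>-\<^sup>\<alpha>\<close> on the unit interval (lemma \<open>caputo_delta_average\<close>). Smoothness and strong convexity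
  put the second derivative of every coordinate slice into \<open>[\<mu>, L]\<close>. Replacing it by the midpoint
  \<open>(L + \<mu>) / 2\<close> makes the average exactly \<open>g'(x) + K1 h\<close>, where \<open>\<gamma>\<close> enters as the mean of the
  density, and the half-width \<open>(L - \<mu>) / 2\<close> bounds the error of this replacement by \<open>K2 \<bar>h\<bar>\<close>
  (lemma \<open>caputo_delta_approx\<close>). The affine model of \<open>g'\<close> is compared with \<open>g'\<close> through
  difference quotients rather than through an integral of \<open>g''\<close>, because \<open>g''\<close> may be discontinuous.

  The choice \<open>h = - \<lambda> \<partial>\<^sub>j f(x)\<close> makes the error proportional to the partial derivative itself.
  Hence the fractional gradient differs from \<open>a \<nabla>f(x)\<close> by at most \<open>b \<parallel>\<nabla>f(x)\<parallel>\<close>, with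
  \<open>a = 1 - K1 \<lambda>\<close> and \<open>b = K2 \<bar>\<lambda>\<bar>\<close> (lemma \<open>caputo_gradient_relative_error\<close>). Expanding the square of the
  new distance to the minimizer and using cocoercivity and strong monotonicity of the gradient
  then gives the contraction factor (lemma \<open>inexact_gradient_step\<close>).
\<close>

section \<open>Gradients of smooth and strongly convex functions\<close>

lemma GDERIV_gradient:
  fixes f :: "'a::euclidean_space \<Rightarrow> real"
  assumes "f differentiable (at x)"
  shows "GDERIV f x :> gradient f x"
proof -
  obtain f' where f': "(f has_derivative f') (at x)"
    using assms unfolding differentiable_def by blast
  have lin: "linear f'"
    using f' by (rule has_derivative_linear)
  have "f' = (\<lambda>h. h \<bullet> adjoint f' 1)"
    by (rule ext) (simp add: adjoint_works[OF lin])
  with f' have D: "GDERIV f x :> adjoint f' 1"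
    by (simp add: gderiv_def)
  then show ?thesis
    using gradient_eqI[OF D] by simp
qed

lemma L_smoothD:
  assumes "L_smooth L f"
  shows "f y \<le> f x + gradient f x \<bullet> (y - x) + L / 2 * (norm (y - x))\<^sup>2"
  using abs_le_D1[OF assms[unfolded L_smooth_def, rule_format, of y x]] by linarith

lemma strongly_convexD:
  assumes "strongly_convex \<mu> f"
  shows "f x + gradient f x \<bullet> (y - x) + \<mu> / 2 * (norm (y - x))\<^sup>2 \<le> f y"
  using assms[unfolded strongly_convex_def, rule_format, of y x] by linarith

text \<open>A step of length \<open>1 / L\<close> along the negative gradient would otherwise push the value
  strictly below the minimum.\<close>

lemma gradient_eq_0_at_arg_min:
  fixes f :: "'a::real_inner \<Rightarrow> real"
  assumes "L > 0" "L_smooth L f" "is_arg_min f (\<lambda>_. True) z"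
  shows "gradient f z = 0"
proof -
  let ?g = "gradient f z"
  have "f z \<le> f (z - (1 / L) *\<^sub>R ?g)"
    using assms(3) by (auto simp: is_arg_min_linorder)
  also have "\<dots> \<le> f z - (1 / L) * (norm ?g)\<^sup>2 + L / 2 * (norm ((1 / L) *\<^sub>R ?g))\<^sup>2"
    using L_smoothD[OF assms(2), of "z - (1 / L) *\<^sub>R ?g" z] by (simp add: dot_square_norm)
  also have "\<dots> = f z - (norm ?g)\<^sup>2 / (2 * L)"
    using assms(1) by (simp add: power_mult_distrib power2_eq_square field_simps)
  finally have "(norm ?g)\<^sup>2 \<le> 0"
    using assms(1) by (simp add: field_simps)
  then show ?thesis
    by simp
qed

lemma strongly_monotone_gradient:
  fixes f :: "'a::real_inner \<Rightarrow> real"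
  assumes "strongly_convex \<mu> f"
  shows "\<mu> * (norm (y - z))\<^sup>2 \<le> (gradient f y - gradient f z) \<bullet> (y - z)"
  using strongly_convexD[OF assms, of y z] strongly_convexD[OF assms, of z y]
  by (simp add: norm_minus_commute inner_diff field_simps)

lemma L_smooth_gradient_upper:
  fixes f :: "'a::real_inner \<Rightarrow> real"
  assumes "L_smooth L f"
  shows "(gradient f y - gradient f z) \<bullet> (y - z) \<le> L * (norm (y - z))\<^sup>2"
  using L_smoothD[OF assms, of y z] L_smoothD[OF assms, of z y]
  by (simp add: norm_minus_commute inner_diff field_simps)

text \<open>Following the tangent plane at \<open>y\<close> from below and the quadratic upper bound at \<open>z\<close> to the
  common point \<open>z + (\<nabla>f(y) - \<nabla>f(z)) / L\<close>, which is where the gap between the two is smallest,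
  gives one half of the inequality; the other half is the same with \<open>y\<close> and \<open>z\<close> exchanged.\<close>

lemma gradient_cocoercive:
  fixes f :: "'a::real_inner \<Rightarrow> real"
  assumes "L > 0" "L_smooth L f" "strongly_convex \<mu> f" "\<mu> \<ge> 0"
  shows "(norm (gradient f y - gradient f z))\<^sup>2 / L \<le> (gradient f y - gradient f z) \<bullet> (y - z)"
proof -
  have half: "f v + gradient f v \<bullet> (u - v) + (norm (gradient f v - gradient f u))\<^sup>2 / (2 * L) \<le> f u"
    for u v
  proof -
    define d where "d = gradient f v - gradient f u"
    define w where "w = u + (1 / L) *\<^sub>R d"
    have "f v + gradient f v \<bullet> (w - v) \<le> f w"
    proof -
      have "0 \<le> \<mu> / 2 * (norm (w - v))\<^sup>2"
        using assms(4) by simp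
      then show ?thesis
        using strongly_convexD[OF assms(3), of v w] by linarith
    qed
    also have "\<dots> \<le> f u + gradient f u \<bullet> (w - u) + L / 2 * (norm (w - u))\<^sup>2"
      by (rule L_smoothD[OF assms(2)])
    finally have "f v + gradient f v \<bullet> (w - v) \<le> f u + gradient f u \<bullet> (w - u) + L / 2 * (norm (w - u))\<^sup>2" .
    moreover have "gradient f v \<bullet> (w - v) - gradient f u \<bullet> (w - u)
        = gradient f v \<bullet> (u - v) + (norm d)\<^sup>2 / L"
    proof -
      have "gradient f v \<bullet> (w - v) - gradient f u \<bullet> (w - u)
          = gradient f v \<bullet> (u - v) + d \<bullet> ((1 / L) *\<^sub>R d)"
        unfolding w_def d_def by (simp add: inner_diff inner_add algebra_simps)
      then show ?thesis
        by (simp add: dot_square_norm)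
    qed
    moreover have "L / 2 * (norm (w - u))\<^sup>2 = (norm d)\<^sup>2 / (2 * L)"
      using assms(1) by (simp add: w_def power_mult_distrib power2_eq_square field_simps)
    moreover have "(norm d)\<^sup>2 / L = 2 * ((norm d)\<^sup>2 / (2 * L))"
      by simp
    ultimately show ?thesis
      unfolding d_def by linarith
  qed
  have "(norm (gradient f y - gradient f z))\<^sup>2 / L
      = 2 * ((norm (gradient f y - gradient f z))\<^sup>2 / (2 * L))"
    by simp
  then show ?thesis
    using half[of y z] half[of z y]
    by (simp add: norm_minus_commute inner_diff)
qed

section \<open>The fractional operator as a weighted average\<close>

text \<open>Both orientations of the integral are absorbed by the substitution \<open>t = x - (x - c) u\<close>.\<close>

lemma LBINT_segment:
  fixes F :: "real \<Rightarrow> real"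
  assumes "c \<noteq> x"
  shows "(LBINT t=c..x. F t) = (x - c) * (LBINT u:{0<..<1}. F (x - (x - c) * u))"
proof -
  define S where "S = {min c x<..<max c x}"
  have ind: "indicator S (x + (c - x) * u) = (indicator {0<..<1} u :: real)" for u
  proof -
    have "x + (c - x) * u \<in> S \<longleftrightarrow> u \<in> {0<..<1}"
    proof (cases "c < x")
      case True
      have "x + (c - x) * u \<in> S \<longleftrightarrow> (x - c) * u < (x - c) * 1 \<and> 0 < (x - c) * u"
        using True by (auto simp: S_def algebra_simps)
      also have "\<dots> \<longleftrightarrow> u \<in> {0<..<1}"
        using True by (subst mult_less_cancel_left_pos) (auto simp: zero_less_mult_iff)
      finally show ?thesis .
    next
      case False
      then have c: "c > x" using assms by simp
      have "x + (c - x) * u \<in> S \<longleftrightarrow> (c - x) * u < (c - x) * 1 \<and> 0 < (c - x) * u"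
        using c by (auto simp: S_def algebra_simps)
      also have "\<dots> \<longleftrightarrow> u \<in> {0<..<1}"
        using c by (subst mult_less_cancel_left_pos) (auto simp: zero_less_mult_iff)
      finally show ?thesis .
    qed
    then show ?thesis
      by (simp add: indicator_def)
  qed
  have "(LBINT t=c..x. F t) = sgn (x - c) * (LBINT t:S. F t)"
    using assms by (auto simp: interval_lebesgue_integral_def S_def min_def max_def)
  also have "(LBINT t:S. F t) = (\<integral>t. indicator S t * F t \<partial>lborel)"
    by (simp add: set_lebesgue_integral_def)
  also have "\<dots> = \<bar>x - c\<bar> * (\<integral>u. indicator S (x + (c - x) * u) * F (x + (c - x) * u) \<partial>lborel)"
    using assms by (subst lborel_integral_real_affine[where c="c - x" and t=x]) auto
  also have "\<dots> = \<bar>x - c\<bar> * (LBINT u:{0<..<1}. F (x - (x - c) * u))"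
    unfolding ind by (simp add: set_lebesgue_integral_def algebra_simps)
  finally show ?thesis
    by (simp add: sgn_mult_abs flip: mult.assoc)
qed

lemma caputo_deriv_segment:
  assumes "c \<noteq> x" "\<lceil>\<nu>\<rceil> = int n"
  shows "caputo_deriv \<nu> c g x =
    sgn (x - c) ^ (n - 1) / Gamma (real n - \<nu>) * (x - c) * \<bar>x - c\<bar> powr (real n - 1 - \<nu>)
      * (LBINT u:{0<..<1}. (deriv ^^ n) g (x - (x - c) * u) * u powr (real n - 1 - \<nu>))"
proof -
  define p where "p = real n - 1 - \<nu>"
  have "(LBINT t=c..x. (deriv ^^ n) g t / \<bar>x - t\<bar> powr (\<nu> - real n + 1))
      = (x - c) * (LBINT u:{0<..<1}. (deriv ^^ n) g (x - (x - c) * u)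
          / \<bar>x - (x - (x - c) * u)\<bar> powr (\<nu> - real n + 1))"
    using assms(1) by (rule LBINT_segment)
  also have "(LBINT u:{0<..<1}. (deriv ^^ n) g (x - (x - c) * u)
          / \<bar>x - (x - (x - c) * u)\<bar> powr (\<nu> - real n + 1))
      = (LBINT u:{0<..<1}. \<bar>x - c\<bar> powr p * ((deriv ^^ n) g (x - (x - c) * u) * u powr p))"
  proof (rule set_lebesgue_integral_cong)
    show "\<forall>u. u \<in> {0<..<1} \<longrightarrow>
        (deriv ^^ n) g (x - (x - c) * u) / \<bar>x - (x - (x - c) * u)\<bar> powr (\<nu> - real n + 1)
        = \<bar>x - c\<bar> powr p * ((deriv ^^ n) g (x - (x - c) * u) * u powr p)"
    proof (intro allI impI)
      fix u :: real
      assume u: "u \<in> {0<..<1}"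
      have e: "\<nu> - real n + 1 = - p" by (simp add: p_def)
      have "\<bar>x - (x - (x - c) * u)\<bar> = \<bar>x - c\<bar> * u"
        using u by (simp add: abs_mult)
      then have "1 / \<bar>x - (x - (x - c) * u)\<bar> powr (\<nu> - real n + 1) = \<bar>x - c\<bar> powr p * u powr p"
        using u by (simp add: e powr_minus powr_mult divide_inverse)
      then show "(deriv ^^ n) g (x - (x - c) * u) / \<bar>x - (x - (x - c) * u)\<bar> powr (\<nu> - real n + 1)
        = \<bar>x - c\<bar> powr p * ((deriv ^^ n) g (x - (x - c) * u) * u powr p)"
        by (metis (no_types, opaque_lifting) mult.left_commute mult.right_neutral times_divide_eq_right)
    qed
  qed simp
  also have "\<dots> = \<bar>x - c\<bar> powr p * (LBINT u:{0<..<1}. (deriv ^^ n) g (x - (x - c) * u) * u powr p)"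
    by simp
  finally have eq: "(LBINT t=c..x. (deriv ^^ n) g t / \<bar>x - t\<bar> powr (\<nu> - real n + 1))
      = (x - c) * (\<bar>x - c\<bar> powr p * (LBINT u:{0<..<1}. (deriv ^^ n) g (x - (x - c) * u) * u powr p))" .
  have n: "nat \<lceil>\<nu>\<rceil> = n"
    using assms(2) by simp
  show ?thesis
    unfolding caputo_deriv_def Let_def n eq p_def by (simp only: mult.assoc)
qed

text \<open>The powers of \<open>\<bar>x - c\<bar>\<close> cancel and \<open>\<Gamma>(2 - \<alpha>) / \<Gamma>(1 - \<alpha>) = 1 - \<alpha>\<close>, which turns the kernel
  into the probability density \<open>(1 - \<alpha>) u\<^sup>-\<^sup>\<alpha>\<close> on the unit interval.\<close>

lemma caputo_delta_average:
  fixes g :: "real \<Rightarrow> real"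
  assumes "0 < \<alpha>" "\<alpha> < 1" "c \<noteq> x"
  shows "caputo_delta \<alpha> \<beta> c g x =
    (1 - \<alpha>) * ((LBINT u:{0<..<1}. deriv g (x - (x - c) * u) * u powr (-\<alpha>))
      + \<beta> * (x - c) * (LBINT u:{0<..<1}. deriv (deriv g) (x - (x - c) * u) * u powr (-\<alpha>)))"
proof -
  define I1 where "I1 = (LBINT u:{0<..<1}. deriv g (x - (x - c) * u) * u powr (-\<alpha>))"
  define I2 where "I2 = (LBINT u:{0<..<1}. deriv (deriv g) (x - (x - c) * u) * u powr (-\<alpha>))"
  define P where "P = \<bar>x - c\<bar> powr \<alpha>"
  have P: "P > 0" "\<bar>x - c\<bar> powr (-\<alpha>) = 1 / P"
    using assms by (auto simp: P_def powr_minus divide_inverse)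
  have C1: "\<lceil>\<alpha>\<rceil> = int 1" "\<lceil>1 + \<alpha>\<rceil> = int 2"
    using assms by (auto intro!: ceiling_unique)
  have G: "Gamma (2 - \<alpha>) = (1 - \<alpha>) * Gamma (1 - \<alpha>)"
  proof -
    have "1 - \<alpha> \<notin> \<int>\<^sub>\<le>\<^sub>0"
      using assms nonpos_Ints_nonpos by force
    from Gamma_plus1[OF this] show ?thesis by simp
  qed
  have Gpos: "Gamma (1 - \<alpha>) > 0"
    using assms by (intro Gamma_real_pos) simp
  have D1: "caputo_deriv \<alpha> c g x = 1 / Gamma (1 - \<alpha>) * (x - c) * (1 / P) * I1"
    using caputo_deriv_segment[OF assms(3) C1(1), of g] by (simp add: I1_def P)
  have D2: "caputo_deriv (1 + \<alpha>) c g x = sgn (x - c) / Gamma (1 - \<alpha>) * (x - c) * (1 / P) * I2"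
    using caputo_deriv_segment[OF assms(3) C1(2), of g] by (simp add: I2_def P numeral_2_eq_2)
  have s: "\<bar>x - c\<bar> * sgn (x - c) = x - c"
    by (simp add: abs_mult_sgn)
  have "caputo_delta \<alpha> \<beta> c g x = Gamma (2 - \<alpha>) * P / (x - c) *
      (1 / Gamma (1 - \<alpha>) * (x - c) * (1 / P) * I1
       + \<beta> * \<bar>x - c\<bar> * (sgn (x - c) / Gamma (1 - \<alpha>) * (x - c) * (1 / P) * I2))"
    using assms(3) by (simp add: caputo_delta_def D1 D2 P_def)
  also have "\<dots> = (1 - \<alpha>) * (I1 + \<beta> * (\<bar>x - c\<bar> * sgn (x - c)) * I2)"
    unfolding G using assms(3) P(1) Gpos by (simp add: field_simps)
  finally show ?thesis
    unfolding s I1_def I2_def .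
qed

lemma LBINT_unit_powr:
  fixes p :: real
  assumes "p > -1"
  shows "set_integrable lborel {0<..<1} (\<lambda>u. u powr p)"
    and "(LBINT u:{0<..<1}. u powr p) = 1 / (p + 1)"
proof -
  let ?F = "\<lambda>u::real. u powr (p + 1) / (p + 1)"
  have F: "DERIV ?F u :> u powr p" if "0 < ereal u" "ereal u < 1" for u
    using that assms by (auto intro!: derivative_eq_intros)
  have cont: "isCont (\<lambda>u. u powr p) u" if "0 < ereal u" "ereal u < 1" for u
    using that by (auto intro!: continuous_intros)
  have 0: "((?F \<circ> real_of_ereal) \<longlongrightarrow> 0) (at_right 0)"
  proof -
    have "((\<lambda>u::real. u powr (p + 1)) \<longlongrightarrow> 0) (at_right 0)"
      using assms
      by (intro tendsto_zero_powrI[where b="p + 1"] tendsto_intros)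
        (auto simp: eventually_at_right_less eventually_at_filter)
    then have "(?F \<longlongrightarrow> 0) (at_right 0)"
      using assms by (auto intro: tendsto_eq_intros)
    then show ?thesis
      by (simp add: zero_ereal_def ereal_tendsto_simps)
  qed
  have 1: "((?F \<circ> real_of_ereal) \<longlongrightarrow> 1 / (p + 1)) (at_left 1)"
  proof -
    have "(?F \<longlongrightarrow> 1 / (p + 1)) (at_left 1)"
      using assms by (auto intro!: tendsto_eq_intros)
    then show ?thesis
      by (simp add: one_ereal_def ereal_tendsto_simps)
  qed
  note FTC = interval_integral_FTC_nonneg[OF _ F cont _ 0 1, simplified]
  show "set_integrable lborel {0<..<1} (\<lambda>u. u powr p)"
    using FTC(1) by (simp add: zero_ereal_def one_ereal_def)
  show "(LBINT u:{0<..<1}. u powr p) = 1 / (p + 1)"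
    using FTC(2) by (simp add: zero_ereal_def one_ereal_def interval_lebesgue_integral_def)
qed

text \<open>A derivative is a pointwise limit of continuous difference quotients. This makes the
  average of a possibly discontinuous second derivative meaningful.\<close>

lemma borel_measurable_derivative:
  fixes g g' :: "real \<Rightarrow> real"
  assumes "\<And>t. (g has_real_derivative g' t) (at t)"
  shows "g' \<in> borel_measurable borel"
proof (rule borel_measurable_LIMSEQ_real)
  have [measurable]: "g \<in> borel_measurable borel"
    using assms by (intro borel_measurable_continuous_onI continuous_at_imp_continuous_on)
      (auto intro: DERIV_isCont)
  show "(\<lambda>t. (g (t + 1 / real (Suc n)) - g t) / (1 / real (Suc n))) \<in> borel_measurable borel" for n
    by measurable
  show "(\<lambda>n. (g (t + 1 / real (Suc n)) - g t) / (1 / real (Suc n))) \<longlonglongrightarrow> g' t" for t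
  proof -
    have "((\<lambda>h. (g (t + h) - g t) / h) \<longlongrightarrow> g' t) (at 0)"
      using assms[of t] by (simp add: DERIV_def)
    moreover have "filterlim (\<lambda>n. 1 / real (Suc n)) (at 0) sequentially"
      unfolding filterlim_at using LIMSEQ_inverse_real_of_nat by (auto simp: inverse_eq_divide)
    ultimately show ?thesis
      by (rule filterlim_compose)
  qed
qed

lemma abs_derivative_le_Lipschitz:
  fixes g :: "real \<Rightarrow> real"
  assumes "(g has_real_derivative d) (at t)" "\<And>y z. \<bar>g y - g z\<bar> \<le> D * \<bar>y - z\<bar>"
  shows "\<bar>d\<bar> \<le> D"
proof -
  have "((\<lambda>h. \<bar>(g (t + h) - g t) / h\<bar>) \<longlongrightarrow> \<bar>d\<bar>) (at 0)"
    using assms(1) by (intro tendsto_rabs) (simp add: DERIV_def)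
  moreover have "eventually (\<lambda>h. \<bar>(g (t + h) - g t) / h\<bar> \<le> D) (at 0)"
    unfolding eventually_at_filter
    using assms(2)[of "t + _" t] by (auto simp: abs_divide divide_le_eq intro!: always_eventually)
  ultimately show ?thesis
    by (rule tendsto_upperbound) simp
qed

text \<open>If \<open>g'\<close> were exactly affine with slope \<open>m\<close>, the average would equal
  \<open>g'(x) + m (\<beta> - \<gamma>) (x - c)\<close>, because the density \<open>(1 - \<alpha>) u\<^sup>-\<^sup>\<alpha>\<close> has total mass one and mean
  \<open>\<gamma> = (1 - \<alpha>) / (2 - \<alpha>)\<close>. In general the deviation of \<open>g'\<close> from that affine function is at most
  \<open>D \<bar>x - c\<bar> u\<close> at \<open>x - (x - c) u\<close>, and the deviation of \<open>g''\<close> from \<open>m\<close> is at most \<open>D\<close>; averaging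
  these two errors gives the bound.\<close>

lemma caputo_delta_approx:
  fixes g g' g'' :: "real \<Rightarrow> real"
  assumes \<alpha>: "0 < \<alpha>" "\<alpha> < 1"
    and g: "\<And>t. (g has_real_derivative g' t) (at t)"
    and g': "\<And>t. (g' has_real_derivative g'' t) (at t)"
    and near: "\<And>y z. \<bar>g' y - g' z - m * (y - z)\<bar> \<le> D * \<bar>y - z\<bar>"
    and \<gamma>: "\<gamma> = (1 - \<alpha>) / (2 - \<alpha>)"
  shows "\<bar>caputo_delta \<alpha> \<beta> c g x - g' x - m * (\<beta> - \<gamma>) * (x - c)\<bar> \<le> D * (\<bar>\<beta>\<bar> + \<gamma>) * \<bar>x - c\<bar>"
proof (cases "c = x")
  case True
  then show ?thesis
    using DERIV_imp_deriv[OF g] by (simp add: caputo_delta_def)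
next
  case False
  define h where "h = x - c"
  let ?U = "{0<..<1::real}"
  define w where "w = (\<lambda>u::real. u powr (-\<alpha>))"
  define v where "v = (\<lambda>u::real. u powr (1 - \<alpha>))"
  have dg: "deriv g = g'" "deriv g' = g''"
    using g g' by (auto intro!: ext DERIV_imp_deriv)
  have near2: "\<bar>g'' t - m\<bar> \<le> D" for t
  proof (rule abs_derivative_le_Lipschitz)
    show "((\<lambda>y. g' y - m * y) has_real_derivative g'' t - m) (at t)"
      by (auto intro!: derivative_eq_intros g')
    show "\<bar>g' y - m * y - (g' z - m * z)\<bar> \<le> D * \<bar>y - z\<bar>" for y z
      using near[of y z] by (simp add: algebra_simps)
  qed
  have D: "D \<ge> 0"
    using near2[of 0] by simp
  have wv: "v u = u * w u" "w u \<ge> 0" if "u \<in> ?U" for u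
    using that by (auto simp: v_def w_def powr_diff powr_minus divide_inverse)
  have wI: "set_integrable lborel ?U w" and wE: "(LBINT u:?U. w u) = 1 / (1 - \<alpha>)"
    using LBINT_unit_powr[of "-\<alpha>"] \<alpha> by (auto simp: w_def)
  have vI: "set_integrable lborel ?U v" and vE: "(LBINT u:?U. v u) = 1 / (2 - \<alpha>)"
    using LBINT_unit_powr[of "1 - \<alpha>"] \<alpha> by (auto simp: v_def)
  have [measurable]: "g' \<in> borel_measurable borel" "g'' \<in> borel_measurable borel"
    "w \<in> borel_measurable borel"
    using borel_measurable_derivative[OF g] borel_measurable_derivative[OF g']
    by (auto simp: w_def)
  \<comment> \<open>errors of the affine model for the first and for the second derivative, times the kernel\<close>
  define r where "r = (\<lambda>u. (g' (x - h * u) - g' x + m * h * u) * w u)"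
  define s where "s = (\<lambda>u. (g'' (x - h * u) - m) * w u)"
  have rb: "\<bar>r u\<bar> \<le> D * \<bar>h\<bar> * v u" if "u \<in> ?U" for u
  proof -
    have "\<bar>g' (x - h * u) - g' x + m * h * u\<bar> \<le> D * (\<bar>h\<bar> * u)"
      using near[of "x - h * u" x] that by (simp add: abs_mult algebra_simps)
    then have "\<bar>r u\<bar> \<le> D * (\<bar>h\<bar> * u) * w u"
      unfolding r_def abs_mult using wv(2)[OF that] by (simp add: mult_right_mono)
    then show ?thesis
      by (simp add: wv(1)[OF that] algebra_simps)
  qed
  have sb: "\<bar>s u\<bar> \<le> D * w u" if "u \<in> ?U" for u
    unfolding s_def abs_mult using wv(2)[OF that] near2 by (simp add: mult_right_mono)
  have rI: "set_integrable lborel ?U r"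
  proof (rule set_integrable_bound)
    show "set_integrable lborel ?U (\<lambda>u. D * \<bar>h\<bar> * v u)"
      using vI by simp
    show "set_borel_measurable lborel ?U r"
      unfolding set_borel_measurable_def r_def by measurable
    show "AE u in lborel. u \<in> ?U \<longrightarrow> norm (r u) \<le> norm (D * \<bar>h\<bar> * v u)"
      using rb by (intro AE_I2 impI) (metis abs_ge_self order_trans real_norm_def)
  qed
  have sI: "set_integrable lborel ?U s"
  proof (rule set_integrable_bound)
    show "set_integrable lborel ?U (\<lambda>u. D * w u)"
      using wI by simp
    show "set_borel_measurable lborel ?U s"
      unfolding set_borel_measurable_def s_def by measurable
    show "AE u in lborel. u \<in> ?U \<longrightarrow> norm (s u) \<le> norm (D * w u)"
      using sb by (intro AE_I2 impI) (metis abs_ge_self order_trans real_norm_def)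
  qed
  have abs_LBINT: "\<bar>LBINT u:?U. a u\<bar> \<le> (LBINT u:?U. b u)"
    if "set_integrable lborel ?U a" "set_integrable lborel ?U b" "\<And>u. u \<in> ?U \<Longrightarrow> \<bar>a u\<bar> \<le> b u"
    for a b :: "real \<Rightarrow> real"
  proof -
    have "(LBINT u:?U. a u) \<le> (LBINT u:?U. b u)"
      using that(1,2) abs_le_D1[OF that(3)] by (rule set_integral_mono)
    moreover have "(LBINT u:?U. - b u) \<le> (LBINT u:?U. a u)"
    proof (rule set_integral_mono)
      show "set_integrable lborel ?U (\<lambda>u. - b u)"
        using that(2) by (simp add: set_integrable_def)
      show "- b u \<le> a u" if "u \<in> ?U" for u
        using \<open>\<And>u. u \<in> ?U \<Longrightarrow> \<bar>a u\<bar> \<le> b u\<close>[OF that] by linarith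
    qed (rule that(1))
    ultimately show ?thesis
      by (simp add: set_lebesgue_integral_def)
  qed
  have R: "\<bar>LBINT u:?U. r u\<bar> \<le> D * \<bar>h\<bar> / (2 - \<alpha>)"
    using abs_LBINT[OF rI _ rb] vI vE by simp
  have S: "\<bar>LBINT u:?U. s u\<bar> \<le> D / (1 - \<alpha>)"
    using abs_LBINT[OF sI _ sb] wI wE by simp
  have I1: "(LBINT u:?U. g' (x - h * u) * w u)
      = (LBINT u:?U. r u) + g' x * (1 / (1 - \<alpha>)) - m * h * (1 / (2 - \<alpha>))"
  proof -
    have "(LBINT u:?U. g' (x - h * u) * w u) = (LBINT u:?U. (r u + g' x * w u) - m * h * v u)"
      by (intro set_lebesgue_integral_cong) (auto simp: r_def wv algebra_simps)
    also have "\<dots> = (LBINT u:?U. r u) + g' x * (1 / (1 - \<alpha>)) - m * h * (1 / (2 - \<alpha>))"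
      using rI wI vI by (simp add: set_integral_add set_integral_diff wE vE)
    finally show ?thesis .
  qed
  have I2: "(LBINT u:?U. g'' (x - h * u) * w u) = (LBINT u:?U. s u) + m * (1 / (1 - \<alpha>))"
  proof -
    have "(LBINT u:?U. g'' (x - h * u) * w u) = (LBINT u:?U. s u + m * w u)"
      by (intro set_lebesgue_integral_cong) (auto simp: s_def algebra_simps)
    also have "\<dots> = (LBINT u:?U. s u) + m * (1 / (1 - \<alpha>))"
      using sI wI by (simp add: set_integral_add wE)
    finally show ?thesis .
  qed
  define R' where "R' = (LBINT u:?U. r u)"
  define S' where "S' = (LBINT u:?U. s u)"
  have "caputo_delta \<alpha> \<beta> c g x
      = (1 - \<alpha>) * ((R' + g' x * (1 / (1 - \<alpha>)) - m * h * (1 / (2 - \<alpha>)))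
        + \<beta> * h * (S' + m * (1 / (1 - \<alpha>))))"
    using caputo_delta_average[OF \<alpha> False, of \<beta> g] I1 I2
    unfolding dg by (simp add: w_def h_def R'_def S'_def)
  also have "\<dots> = (1 - \<alpha>) * R' + g' x - m * h * \<gamma> + \<beta> * h * ((1 - \<alpha>) * S') + \<beta> * h * m"
  proof -
    have mass: "(1 - \<alpha>) * (1 / (1 - \<alpha>)) = 1" and mean: "(1 - \<alpha>) * (1 / (2 - \<alpha>)) = \<gamma>"
      using \<alpha> by (simp_all add: \<gamma>)
    have "k * ((R' + g' x * p - m * h * q) + \<beta> * h * (S' + m * p))
        = k * R' + g' x * (k * p) - m * h * (k * q) + \<beta> * h * (k * S') + \<beta> * h * m * (k * p)"
      for k p q
      by (simp add: algebra_simps)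
    then show ?thesis
      by (simp only: mass mean mult_1_right)
  qed
  finally have "caputo_delta \<alpha> \<beta> c g x - g' x - m * (\<beta> - \<gamma>) * h
      = (1 - \<alpha>) * R' + \<beta> * h * ((1 - \<alpha>) * S')"
    by (simp add: algebra_simps)
  also have "\<bar>\<dots>\<bar> \<le> D * \<bar>h\<bar> * \<gamma> + \<bar>\<beta>\<bar> * \<bar>h\<bar> * D"
  proof -
    have "\<bar>(1 - \<alpha>) * R'\<bar> \<le> (1 - \<alpha>) * (D * \<bar>h\<bar> / (2 - \<alpha>))"
      using R \<alpha> unfolding abs_mult R'_def by (intro mult_mono) auto
    moreover have "(1 - \<alpha>) * (D * \<bar>h\<bar> / (2 - \<alpha>)) = D * \<bar>h\<bar> * \<gamma>"
      by (simp add: \<gamma>)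
    moreover have "\<bar>(1 - \<alpha>) * S'\<bar> \<le> D"
      using S \<alpha> unfolding abs_mult S'_def by (simp add: field_simps)
    then have "\<bar>\<beta> * h * ((1 - \<alpha>) * S')\<bar> \<le> \<bar>\<beta>\<bar> * \<bar>h\<bar> * D"
      by (subst abs_mult) (simp add: abs_mult[of \<beta> h] mult_left_mono)
    ultimately show ?thesis
      by linarith
  qed
  finally show ?thesis
    unfolding h_def by (simp add: algebra_simps)
qed

section \<open>Coordinate slices\<close>

lemma coord_slice_derivative:
  fixes f :: "real ^ 'n::finite \<Rightarrow> real"
  assumes "\<And>z. f differentiable (at z)"
  shows "(coord_slice f j x has_real_derivative
      gradient f (x + (y - x $ j) *\<^sub>R axis j 1) $ j) (at y)"
proof -
  let ?p = "\<lambda>y. x + (y - x $ j) *\<^sub>R axis j 1"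
  have "(?p has_derivative (\<lambda>h. h *\<^sub>R axis j 1)) (at y)"
    by (auto intro!: derivative_eq_intros)
  moreover have "(f has_derivative (\<lambda>h. h \<bullet> gradient f (?p y))) (at (?p y))"
    using GDERIV_gradient[OF assms] by (simp add: gderiv_def)
  ultimately have "((\<lambda>y. f (?p y)) has_derivative (\<lambda>h. (h *\<^sub>R axis j 1) \<bullet> gradient f (?p y))) (at y)"
    by (rule has_derivative_compose)
  moreover have "(\<lambda>h. (h *\<^sub>R axis j 1) \<bullet> gradient f (?p y)) = (*) (gradient f (?p y) $ j)"
    by (auto simp: inner_axis' mult.commute)
  ultimately show ?thesis
    by (simp add: has_field_derivative_def coord_slice_def[abs_def])
qed

lemma coord_slice_second_derivative:
  fixes f :: "real ^ 'n::finite \<Rightarrow> real"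
  assumes "\<And>z. gradient f differentiable (at z)"
  obtains d where "((\<lambda>y. gradient f (x + (y - x $ j) *\<^sub>R axis j 1) $ j) has_real_derivative d) (at y)"
proof -
  let ?p = "\<lambda>y. x + (y - x $ j) *\<^sub>R axis j 1"
  obtain F where F: "(gradient f has_derivative F) (at (?p y))"
    using assms unfolding differentiable_def by blast
  have "(?p has_derivative (\<lambda>h. h *\<^sub>R axis j 1)) (at y)"
    by (auto intro!: derivative_eq_intros)
  then have "((\<lambda>y. gradient f (?p y)) has_derivative (\<lambda>h. F (h *\<^sub>R axis j 1))) (at y)"
    using F by (rule has_derivative_compose)
  then have "((\<lambda>y. gradient f (?p y) $ j) has_derivative (\<lambda>h. F (h *\<^sub>R axis j 1) $ j)) (at y)"
    by (rule bounded_linear.has_derivative[OF bounded_linear_vec_nth])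
  moreover have "(\<lambda>h. F (h *\<^sub>R axis j 1) $ j) = (*) (F (axis j 1) $ j)"
    by (auto simp: linear_cmul[OF has_derivative_linear[OF F]])
  ultimately have "((\<lambda>y. gradient f (?p y) $ j) has_real_derivative F (axis j 1) $ j) (at y)"
    by (simp add: has_field_derivative_def)
  then show ?thesis
    by (rule that)
qed

text \<open>The difference quotients of a coordinate slice's derivative lie in the interval \<open>[\<mu>, L]\<close>;
  this is the same fact, centred at the midpoint of that interval.\<close>

lemma coord_slice_gradient_near_affine:
  fixes f :: "real ^ 'n::finite \<Rightarrow> real"
  assumes "L_smooth L f" "strongly_convex \<mu> f"
  shows "\<bar>gradient f (x + (y - x $ j) *\<^sub>R axis j 1) $ j - gradient f (x + (z - x $ j) *\<^sub>R axis j 1) $ j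
      - (L + \<mu>) / 2 * (y - z)\<bar> \<le> (L - \<mu>) / 2 * \<bar>y - z\<bar>"
proof -
  let ?p = "\<lambda>y. x + (y - x $ j) *\<^sub>R axis j 1"
  define d where "d = y - z"
  define q where "q = gradient f (?p y) $ j - gradient f (?p z) $ j"
  have diff: "?p y - ?p z = d *\<^sub>R axis j 1"
    by (simp add: d_def algebra_simps)
  have n: "(norm (?p y - ?p z))\<^sup>2 = d\<^sup>2"
    unfolding diff by (simp add: norm_axis_1)
  have i: "(gradient f (?p y) - gradient f (?p z)) \<bullet> (?p y - ?p z) = q * d"
    unfolding diff by (simp add: q_def inner_axis mult.commute)
  have lo: "\<mu> * d\<^sup>2 \<le> q * d"
    using strongly_monotone_gradient[OF assms(2), of "?p y" "?p z"] unfolding n i .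
  have up: "q * d \<le> L * d\<^sup>2"
    using L_smooth_gradient_upper[OF assms(1), of "?p y" "?p z"] unfolding n i .
  have "\<bar>q - (L + \<mu>) / 2 * d\<bar> \<le> (L - \<mu>) / 2 * \<bar>d\<bar>"
  proof (cases "d = 0")
    case True
    then have "y = z" by (simp add: d_def)
    then show ?thesis by (simp add: q_def True)
  next
    case False
    have "\<bar>q - (L + \<mu>) / 2 * d\<bar> * \<bar>d\<bar> = \<bar>q * d - (L + \<mu>) / 2 * d\<^sup>2\<bar>"
      by (simp add: power2_eq_square algebra_simps flip: abs_mult)
    also have "\<dots> \<le> (L - \<mu>) / 2 * d\<^sup>2"
      using lo up by (simp add: abs_le_iff field_simps)
    also have "\<dots> = ((L - \<mu>) / 2 * \<bar>d\<bar>) * \<bar>d\<bar>"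
      by (simp add: power2_eq_square)
    finally show ?thesis
      using False by simp
  qed
  then show ?thesis
    by (simp add: q_def d_def)
qed

lemma modulus_ge_convexity:
  fixes f :: "real ^ 'n::finite \<Rightarrow> real"
  assumes "L_smooth L f" "strongly_convex \<mu> f"
  shows "\<mu> \<le> L"
proof -
  have "0 \<le> (L - \<mu>) / 2 * \<bar>1 - 0\<bar>"
    using coord_slice_gradient_near_affine[OF assms, of _ 1 _ 0] abs_ge_zero order_trans by blast
  then show ?thesis
    by simp
qed

text \<open>Since every displacement \<open>x\<^sup>(\<^sup>j\<^sup>) - c\<^sup>(\<^sup>j\<^sup>)\<close> is the same multiple of the partial derivative, the
  coordinatewise error is proportional to that partial derivative, so the fractional gradient is
  a scalar multiple of the gradient up to a relative error.\<close>

lemma caputo_gradient_relative_error: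
  fixes f :: "real ^ 'n::finite \<Rightarrow> real"
  assumes "twice_differentiable f" "L_smooth L f" "strongly_convex \<mu> f" "0 < \<alpha>" "\<alpha> < 1"
    and \<gamma>: "\<gamma> = (1 - \<alpha>) / (2 - \<alpha>)"
    and xc: "x - c = - lam *\<^sub>R gradient f x"
  shows "norm (caputo_gradient \<alpha> \<beta> c f x - (1 - (L + \<mu>) / 2 * (\<beta> - \<gamma>) * lam) *\<^sub>R gradient f x)
    \<le> (L - \<mu>) / 2 * (\<bar>\<beta>\<bar> + \<gamma>) * \<bar>lam\<bar> * norm (gradient f x)"
proof -
  define b where "b = (L - \<mu>) / 2 * (\<bar>\<beta>\<bar> + \<gamma>) * \<bar>lam\<bar>"
  have comp: "\<bar>caputo_delta \<alpha> \<beta> (c $ j) (coord_slice f j x) (x $ j)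
      - (1 - (L + \<mu>) / 2 * (\<beta> - \<gamma>) * lam) * gradient f x $ j\<bar> \<le> b * \<bar>gradient f x $ j\<bar>" for j
  proof -
    define g' where "g' = (\<lambda>y. gradient f (x + (y - x $ j) *\<^sub>R axis j 1) $ j)"
    have g: "(coord_slice f j x has_real_derivative g' y) (at y)" for y
      unfolding g'_def using assms(1) by (intro coord_slice_derivative) (simp add: twice_differentiable_def)
    have "\<forall>y. \<exists>d. (g' has_real_derivative d) (at y)"
      unfolding g'_def using assms(1) coord_slice_second_derivative[of f]
      by (metis twice_differentiable_def)
    then obtain g'' where g': "\<And>y. (g' has_real_derivative g'' y) (at y)"
      by metis
    have near: "\<bar>g' y - g' z - (L + \<mu>) / 2 * (y - z)\<bar> \<le> (L - \<mu>) / 2 * \<bar>y - z\<bar>" for y z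
      unfolding g'_def by (rule coord_slice_gradient_near_affine[OF assms(2,3)])
    have h: "x $ j - c $ j = - lam * gradient f x $ j"
      using arg_cong[OF xc, of "\<lambda>v. v $ j"] by simp
    have "g' (x $ j) = gradient f x $ j"
      by (simp add: g'_def)
    then have "\<bar>caputo_delta \<alpha> \<beta> (c $ j) (coord_slice f j x) (x $ j) - gradient f x $ j
        - (L + \<mu>) / 2 * (\<beta> - \<gamma>) * (- lam * gradient f x $ j)\<bar>
        \<le> (L - \<mu>) / 2 * (\<bar>\<beta>\<bar> + \<gamma>) * \<bar>- lam * gradient f x $ j\<bar>"
      using caputo_delta_approx[OF assms(4,5) g g' near \<gamma>, of \<beta> "c $ j" "x $ j"]
      unfolding h by simp
    moreover have "v - w - k * (- lam * w) = v - (1 - k * lam) * w" for v w k :: real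
      by (simp add: algebra_simps)
    ultimately have "\<bar>caputo_delta \<alpha> \<beta> (c $ j) (coord_slice f j x) (x $ j)
        - (1 - (L + \<mu>) / 2 * (\<beta> - \<gamma>) * lam) * gradient f x $ j\<bar>
        \<le> (L - \<mu>) / 2 * (\<bar>\<beta>\<bar> + \<gamma>) * \<bar>- lam * gradient f x $ j\<bar>"
      by (simp only:)
    then show ?thesis
      unfolding b_def by (simp only: abs_mult abs_minus_cancel mult.assoc)
  qed
  have "b \<ge> 0"
    using modulus_ge_convexity[OF assms(2,3)] assms(4,5) by (simp add: b_def \<gamma>)
  have "norm (caputo_gradient \<alpha> \<beta> c f x - (1 - (L + \<mu>) / 2 * (\<beta> - \<gamma>) * lam) *\<^sub>R gradient f x)
      \<le> norm (b *\<^sub>R gradient f x)"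
  proof (rule norm_le_componentwise_cart)
    fix j
    have "b * \<bar>gradient f x $ j\<bar> \<le> \<bar>b * gradient f x $ j\<bar>"
      by (metis abs_ge_self abs_mult abs_abs)
    then show "norm ((caputo_gradient \<alpha> \<beta> c f x - (1 - (L + \<mu>) / 2 * (\<beta> - \<gamma>) * lam) *\<^sub>R gradient f x) $ j)
      \<le> norm ((b *\<^sub>R gradient f x) $ j)"
      using comp[of j] by (simp add: caputo_gradient_def)
  qed
  also have "\<dots> = b * norm (gradient f x)"
    using \<open>b \<ge> 0\<close> by simp
  finally show ?thesis
    by (simp add: b_def)
qed

section \<open>Descent\<close>

text \<open>Along a perturbed direction \<open>d\<close> the perturbation costs at most \<open>b \<parallel>\<nabla>f(x)\<parallel> \<parallel>x - z\<parallel>\<close> in the inner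
  product with \<open>x - z\<close>, and strong monotonicity bounds this by \<open>b \<parallel>\<nabla>f(x)\<parallel>\<^sup>2 / \<mu>\<close>. The step size
  \<open>(a \<phi> / L - 2 b / \<mu>) / (a + b)\<^sup>2\<close> is the one for which \<open>2 \<eta>\<close> times this cost and the
  bound \<open>\<eta>\<^sup>2 (a + b)\<^sup>2 \<parallel>\<nabla>f(x)\<parallel>\<^sup>2\<close> of the second-order term \<open>\<parallel>\<eta> d\<parallel>\<^sup>2\<close> add up to
  \<open>\<eta> \<phi> a \<parallel>\<nabla>f(x)\<parallel>\<^sup>2 / L\<close>. By cocoercivity that is at most a fraction \<open>\<phi> / 2\<close> of the descent
  \<open>2 \<eta> a \<langle>\<nabla>f(x), x - z\<rangle>\<close>, and strong monotonicity bounds what remains.\<close>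

lemma inexact_gradient_step:
  fixes f :: "'a::real_inner \<Rightarrow> real"
  assumes "L > 0" "\<mu> > 0" "L_smooth L f" "strongly_convex \<mu> f" "is_arg_min f (\<lambda>_. True) z"
    and "\<phi> < 2" "a > 0" "b \<ge> 0"
    and d: "norm (d - a *\<^sub>R gradient f x) \<le> b * norm (gradient f x)"
    and pos: "\<phi> / L * a - 2 * b / \<mu> \<ge> 0"
    and \<eta>: "\<eta> = (\<phi> / L * a - 2 * b / \<mu>) / (a + b)\<^sup>2"
  shows "(norm (x - \<eta> *\<^sub>R d - z))\<^sup>2 \<le> (1 - (2 - \<phi>) * \<mu> * a * \<eta>) * (norm (x - z))\<^sup>2"
proof -
  define g where "g = gradient f x"
  define R where "R = norm (x - z)"
  define G where "G = norm g"
  have gz: "gradient f z = 0"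
    using assms by (intro gradient_eq_0_at_arg_min)
  have coco: "G\<^sup>2 / L \<le> g \<bullet> (x - z)"
    using gradient_cocoercive[OF assms(1,3,4), of x z] assms(2) by (simp add: gz g_def G_def)
  have mono: "\<mu> * R\<^sup>2 \<le> g \<bullet> (x - z)"
    using strongly_monotone_gradient[OF assms(4), of x z] by (simp add: gz g_def R_def)
  have "\<mu> * R \<le> G"
  proof (cases "R = 0")
    case False
    have "\<mu> * R * R \<le> G * R"
      using mono norm_cauchy_schwarz[of g "x - z"] by (simp add: R_def G_def power2_eq_square)
    then show ?thesis
      using False by (simp add: R_def)
  qed (simp add: G_def)
  then have GR: "G * R \<le> G\<^sup>2 / \<mu>"
    using assms(2) mult_left_mono[of "\<mu> * R" G G]
    by (simp add: G_def pos_le_divide_eq power2_eq_square mult_ac)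
  have \<eta>0: "\<eta> \<ge> 0"
    using pos by (simp add: \<eta>)
  have \<eta>2: "\<eta> * (a + b)\<^sup>2 = \<phi> / L * a - 2 * b / \<mu>"
    using assms(7,8) by (simp add: \<eta>)
  have inner: "d \<bullet> (x - z) \<ge> a * (g \<bullet> (x - z)) - b * (G\<^sup>2 / \<mu>)"
  proof -
    have "\<bar>(d - a *\<^sub>R g) \<bullet> (x - z)\<bar> \<le> norm (d - a *\<^sub>R g) * R"
      unfolding R_def by (rule Cauchy_Schwarz_ineq2)
    also have "\<dots> \<le> b * G * R"
      using d by (intro mult_right_mono) (auto simp: g_def G_def R_def)
    also have "\<dots> \<le> b * (G\<^sup>2 / \<mu>)"
      unfolding mult.assoc using GR assms(8) by (rule mult_left_mono)
    finally show ?thesis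
      by (simp add: inner_diff_left)
  qed
  have "norm d \<le> (a + b) * G"
    using norm_triangle_ineq[of "d - a *\<^sub>R g" "a *\<^sub>R g"] d assms(7)
    by (simp add: g_def G_def algebra_simps)
  then have nd: "(norm d)\<^sup>2 \<le> (a + b)\<^sup>2 * G\<^sup>2"
    by (metis norm_ge_zero power_mono power_mult_distrib)
  have "(norm (x - \<eta> *\<^sub>R d - z))\<^sup>2 = (norm ((x - z) - \<eta> *\<^sub>R d))\<^sup>2"
    by (simp add: algebra_simps)
  also have "\<dots> = R\<^sup>2 - 2 * \<eta> * (d \<bullet> (x - z)) + \<eta>\<^sup>2 * (norm d)\<^sup>2"
  proof -
    have "(norm (u - \<eta> *\<^sub>R v))\<^sup>2 = (norm u)\<^sup>2 - 2 * \<eta> * (v \<bullet> u) + \<eta>\<^sup>2 * (norm v)\<^sup>2" for u v :: 'a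
      unfolding power2_norm_eq_inner
      by (simp add: inner_diff inner_commute power2_eq_square algebra_simps)
    then show ?thesis
      by (simp add: R_def)
  qed
  also have "\<dots> \<le> R\<^sup>2 - 2 * \<eta> * (a * (g \<bullet> (x - z)) - b * (G\<^sup>2 / \<mu>)) + \<eta>\<^sup>2 * ((a + b)\<^sup>2 * G\<^sup>2)"
    using inner nd \<eta>0 by (intro add_mono diff_mono mult_left_mono) auto
  also have "\<eta>\<^sup>2 * ((a + b)\<^sup>2 * G\<^sup>2) = \<eta> * (\<phi> / L * a - 2 * b / \<mu>) * G\<^sup>2"
    unfolding \<eta>2[symmetric] by (simp add: power2_eq_square)
  also have "R\<^sup>2 - 2 * \<eta> * (a * (g \<bullet> (x - z)) - b * (G\<^sup>2 / \<mu>)) + \<eta> * (\<phi> / L * a - 2 * b / \<mu>) * G\<^sup>2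
      = R\<^sup>2 - \<eta> * a * (2 * (g \<bullet> (x - z)) - \<phi> * (G\<^sup>2 / L))"
    by (simp add: algebra_simps)
  also have "\<dots> \<le> R\<^sup>2 - \<eta> * a * ((2 - \<phi>) * (\<mu> * R\<^sup>2))"
  proof -
    have "\<phi> \<ge> 0"
    proof -
      have "0 \<le> 2 * b / \<mu>"
        using assms(2,8) by simp
      then have "0 \<le> \<phi> / L * a"
        using pos by linarith
      then show ?thesis
        using assms(1,7) by (simp add: zero_le_mult_iff zero_le_divide_iff)
    qed
    then have "\<phi> * (G\<^sup>2 / L) \<le> \<phi> * (g \<bullet> (x - z))"
      using coco by (rule mult_left_mono[rotated])
    moreover have "(2 - \<phi>) * (\<mu> * R\<^sup>2) \<le> (2 - \<phi>) * (g \<bullet> (x - z))"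
      using mono assms(6) by (intro mult_left_mono) auto
    ultimately have "(2 - \<phi>) * (\<mu> * R\<^sup>2) \<le> 2 * (g \<bullet> (x - z)) - \<phi> * (G\<^sup>2 / L)"
      by (simp add: algebra_simps)
    then show ?thesis
      using \<eta>0 assms(7) by (intro diff_left_mono mult_left_mono) auto
  qed
  finally show ?thesis
    by (simp add: R_def algebra_simps)
qed

text \<open>Perturbations only enlarge the denominator and shrink the numerator, so the gain is at most
  its value \<open>(2 - \<phi>) \<phi> \<mu> / L\<close> at \<open>b = 0\<close>, and \<open>(2 - \<phi>) \<phi> = 1 - (1 - \<phi>)\<^sup>2 \<le> 1\<close>.\<close>

lemma inexact_gradient_gain_le:
  fixes a b :: real
  assumes "L > 0" "\<mu> > 0" "\<phi> < 2" "\<phi> > 0" "a > 0" "b \<ge> 0"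
  shows "(2 - \<phi>) * \<mu> * a * (\<phi> / L * a - 2 * b / \<mu>) / (a + b)\<^sup>2 \<le> \<mu> / L"
proof -
  have "\<phi> / L * a - 2 * b / \<mu> \<le> \<phi> / L * a"
    using assms by simp
  then have "(2 - \<phi>) * \<mu> * a * (\<phi> / L * a - 2 * b / \<mu>) \<le> (2 - \<phi>) * \<mu> * a * (\<phi> / L * a)"
    using assms by (intro mult_left_mono) auto
  also have "\<dots> = ((2 - \<phi>) * \<phi>) * (\<mu> / L * a\<^sup>2)"
    by (simp add: power2_eq_square)
  also have "\<dots> \<le> 1 * (\<mu> / L * a\<^sup>2)"
  proof (rule mult_right_mono)
    show "(2 - \<phi>) * \<phi> \<le> 1"
      using zero_le_power2[of "1 - \<phi>"] by (simp add: power2_eq_square algebra_simps)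
  qed (use assms in auto)
  also have "\<dots> \<le> \<mu> / L * (a + b)\<^sup>2"
    using assms by (simp add: mult_left_mono power_mono divide_right_mono)
  finally show ?thesis
    using assms by (simp add: pos_divide_le_eq)
qed

theorem theorem4p6:
  fixes f :: "real ^ 'n::finite \<Rightarrow> real"
    and xstar :: "real ^ 'n"
    and x c :: "nat \<Rightarrow> real ^ 'n"
    and lam \<eta> :: "nat \<Rightarrow> real"
    and L \<mu> \<alpha> \<beta> \<gamma> K1 K2 \<phi> \<epsilon> :: real
  assumes "twice_differentiable f"
    and "L > 0" and "\<mu> > 0"
    and "L_smooth L f"
    and "strongly_convex \<mu> f"
    and "is_arg_min f (\<lambda>_. True) xstar"
    and "0 < \<alpha>" and "\<alpha> < 1"
    and "\<gamma> = (1 - \<alpha>) / (2 - \<alpha>)"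
    and "K1 = (L + \<mu>) / 2 * (\<beta> - \<gamma>)"
    and "K2 = (if \<beta> \<ge> 0 then (L - \<mu>) / 2 * (\<beta> + \<gamma>) else (\<mu> - L) / 2 * (\<beta> - \<gamma>))"
    and "0 < \<phi>" and "\<phi> < 2" and "\<epsilon> > 0"
    and "\<And>t. \<phi> * (1 - K1 * lam t) / L - 2 * K2 * \<bar>lam t\<bar> / \<mu> > \<epsilon>"
    and "\<And>t. \<eta> t = (\<phi> / L * (1 - K1 * lam t) - 2 * K2 * \<bar>lam t\<bar> / \<mu>)
                    / (1 - K1 * lam t + K2 * \<bar>lam t\<bar>)\<^sup>2"
    and "\<And>t. x t - c t = - lam t *\<^sub>R gradient f (x t)"
    and "\<And>t. x (Suc t) = x t - \<eta> t *\<^sub>R caputo_gradient \<alpha> \<beta> (c t) f (x t)"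
  shows "\<forall>t. (norm (x (Suc t) - xstar))\<^sup>2
              \<le> (1 - (2 - \<phi>) * \<mu> * (1 - K1 * lam t)
                       * (\<phi> / L * (1 - K1 * lam t) - 2 * K2 * \<bar>lam t\<bar> / \<mu>)
                       / (1 - K1 * lam t + K2 * \<bar>lam t\<bar>)\<^sup>2)
                * (norm (x t - xstar))\<^sup>2
           \<and> 1 - (2 - \<phi>) * \<mu> * (1 - K1 * lam t)
                   * (\<phi> / L * (1 - K1 * lam t) - 2 * K2 * \<bar>lam t\<bar> / \<mu>)
                   / (1 - K1 * lam t + K2 * \<bar>lam t\<bar>)\<^sup>2
             \<ge> 1 - \<mu> / L"
proof
  fix t
  define a where "a = 1 - K1 * lam t"
  define b where "b = K2 * \<bar>lam t\<bar>"
  \<comment> \<open>both branches of \<open>K2\<close> are this expression\<close>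
  have K2: "K2 = (L - \<mu>) / 2 * (\<bar>\<beta>\<bar> + \<gamma>)"
    using assms(11) by (auto simp: field_simps)
  have "\<mu> \<le> L"
    using assms(4,5) by (rule modulus_ge_convexity)
  then have b: "b \<ge> 0"
    using assms(7-9) by (simp add: b_def K2)
  have step: "\<phi> / L * a - 2 * b / \<mu> > 0"
    using assms(14) assms(15)[of t] by (simp add: a_def b_def)
  moreover have "2 * b / \<mu> \<ge> 0"
    using b assms(3) by simp
  ultimately have "\<phi> / L * a > 0"
    by linarith
  then have a: "a > 0"
    using assms(2,12) by (metis divide_pos_pos zero_less_mult_pos)
  have \<eta>: "\<eta> t = (\<phi> / L * a - 2 * b / \<mu>) / (a + b)\<^sup>2"
    using assms(16)[of t] by (simp add: a_def b_def mult.assoc)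
  have err: "norm (caputo_gradient \<alpha> \<beta> (c t) f (x t) - a *\<^sub>R gradient f (x t))
      \<le> b * norm (gradient f (x t))"
    using caputo_gradient_relative_error[OF assms(1,4,5,7,8,9,17), of \<beta>]
    by (simp add: a_def b_def K2 assms(10))
  have "(norm (x (Suc t) - xstar))\<^sup>2 \<le> (1 - (2 - \<phi>) * \<mu> * a * \<eta> t) * (norm (x t - xstar))\<^sup>2"
    using inexact_gradient_step[OF assms(2-6,13) a b err _ \<eta>] step by (simp add: assms(18))
  moreover have "(2 - \<phi>) * \<mu> * a * (\<phi> / L * a - 2 * b / \<mu>) / (a + b)\<^sup>2 \<le> \<mu> / L"
    using assms(2,3,13,12) a b by (rule inexact_gradient_gain_le)
  ultimately show "(norm (x (Suc t) - xstar))\<^sup>2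
              \<le> (1 - (2 - \<phi>) * \<mu> * (1 - K1 * lam t)
                       * (\<phi> / L * (1 - K1 * lam t) - 2 * K2 * \<bar>lam t\<bar> / \<mu>)
                       / (1 - K1 * lam t + K2 * \<bar>lam t\<bar>)\<^sup>2)
                * (norm (x t - xstar))\<^sup>2
           \<and> 1 - (2 - \<phi>) * \<mu> * (1 - K1 * lam t)
                   * (\<phi> / L * (1 - K1 * lam t) - 2 * K2 * \<bar>lam t\<bar> / \<mu>)
                   / (1 - K1 * lam t + K2 * \<bar>lam t\<bar>)\<^sup>2
             \<ge> 1 - \<mu> / L"
    by (simp add: \<eta> a_def b_def mult.assoc)
qed

end
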